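(* Let $\mathcal X$ be a non-empty finite set and let $\mathcal Q$ be a set of joint distribution matrices on $\mathcal X$ satisfying $\mathcal M_{\mathcal Q}=\mathcal M^{*}_{\mathcal Q}$. Let $(X_n)_{n\in\mathbb Z}$ be the imprecise Markov chain induced by $\mathcal Q$. Then the chain is stationary with marginal set $\mathcal M_{\mathcal Q}$, i.e. $\operatorname{distr}(X_k)=\mathcal M_{\mathcal Q}$ for every $k\in\mathbb Z$, and it is reversible if and only if $\mathcal Q$ is symmetric, i.e. $\mathcal Q^{\top}=\mathcal Q$, where $\mathcal Q^\top=\{Q^\top\mid Q\in\mathcal Q\}$.
   Context: A joint distribution matrix on the finite set $\mathcal X$ is a matrix $Q=(Q(x,y))_{x,y\in\mathcal X}$ with non-negative entries summing to $1$ (the joint law of a pair of $\mathcal X$-valued variables). Vectors are row vectors and $\mathbf 1$ is the all-ones row vector. The left and right marginal sets of $\mathcal Q$ are $$\mathcal M_{\mathcal Q}=\{\mathbf 1 Q^\top\mid Q\in\mathcal Q\}\ (\text{row sums}),\qquad \mathcal M^*_{\mathcal Q}=\{\mathbf 1 Q\mid Q\in\mathcal Q\}\ (\text{column sums}).$$ The imprecise Markov chain $(X_n)_{n\in\mathbb Z}$ induced by $\mathcal Q$ (under strong independence) is the set of all laws of precise, possibly time-inhomogeneous, Markov chains $(X_n)_{n\in\mathbb Z}$ on $\mathcal X$ such that for every $k\in\mathbb Z$ the joint distribution matrix $Q_k(x,y)=\Pr(X_k=x,X_{k+1}=y)$ belongs to $\mathcal Q$; these are its compatible processes. (Consecutive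 matrices are then necessarily marginally compatible: $\mathbf 1 Q_k=\mathbf 1 Q_{k+1}^\top$. With $q^{(k)}=\mathbf 1Q_k^\top$, the finite-dimensional laws are $\Pr(X_{m:n}=x_{m:n})=\prod_{k=m}^{n-1}Q_k(x_k,x_{k+1})\big/\prod_{k=m+1}^{n-1}q^{(k)}(x_k)$ for $m<n$, with $0/0:=0$.) For integers $m\le n$, $\operatorname{distr}(X_{m:n})$ is the set of joint laws of $(X_m,\dots,X_n)$, as probability mass functions on $\mathcal X^{n-m+1}$, over all compatible processes; $\operatorname{distr}(X_k)$ is the case $m=n=k$. For a probability mass function $p$ on $\mathcal X^N$ let $p^*(x_1,\dots,x_N)=p(x_N,\dots,x_1)$, and let $\operatorname{distr}^*(X_{m:n})=\{p^*\mid p\in\operatorname{distr}(X_{m:n})\}$. The chain is reversible if $\operatorname{distr}^*(X_{m:n})=\operatorname{distr}(X_{m:n})$ for all integers $m\le n$. *)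

theory Defs
  imports "HOL-Probability.Probability"
begin

text \<open>
  The state space is the universe of a type of class \<open>finite\<close>. A matrix \<open>Q(x, y)\<close> is rendered as
  \<open>Q $ x $ y\<close>, the first index being the state at the earlier time; \<open>1\<close> is the all-ones vector.
\<close>

definition joint_distribution_matrix :: "real ^ 'x ^ 'x::finite \<Rightarrow> bool" where
  "joint_distribution_matrix Q \<longleftrightarrow>
     (\<forall>x y. 0 \<le> Q $ x $ y) \<and> (\<Sum>x\<in>UNIV. \<Sum>y\<in>UNIV. Q $ x $ y) = 1"

definition left_marginals :: "(real ^ 'x ^ 'x::finite) set \<Rightarrow> (real ^ 'x) set" where
  "left_marginals \<Q> = {1 v* transpose Q | Q. Q \<in> \<Q>}"

definition right_marginals :: "(real ^ 'x ^ 'x::finite) set \<Rightarrow> (real ^ 'x) set" where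
  "right_marginals \<Q> = {1 v* Q | Q. Q \<in> \<Q>}"

text \<open>
  The law of a process indexed by the integers is a probability measure on the path space, with
  the product of the discrete sigma-algebras; \<open>X\<^sub>k\<close> is the coordinate map \<open>\<lambda>\<omega>. \<omega> k\<close>.
\<close>

definition process_law :: "(int \<Rightarrow> 'x::finite) measure \<Rightarrow> bool" where
  "process_law P \<longleftrightarrow>
     prob_space P \<and> sets P = sets (\<Pi>\<^sub>M k\<in>(UNIV :: int set). count_space (UNIV :: 'x set))"

text \<open>
  Transition probabilities may depend on \<open>k\<close>. The positivity premise is needed because \<open>cond_prob\<close>
  is \<open>0\<close> when the conditioning event is null.
\<close>

definition markov_law :: "(int \<Rightarrow> 'x::finite) measure \<Rightarrow> bool" where
  "markov_law P \<longleftrightarrow> process_law P \<and>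
     (\<forall>m k x y. m \<le> k \<longrightarrow> \<P>(\<omega> in P. \<forall>i\<in>{m..k}. \<omega> i = x i) > 0 \<longrightarrow>
        \<P>(\<omega> in P. \<omega> (k + 1) = y \<bar> \<forall>i\<in>{m..k}. \<omega> i = x i) =
        \<P>(\<omega> in P. \<omega> (k + 1) = y \<bar> \<omega> k = x k))"

definition step_matrix :: "(int \<Rightarrow> 'x::finite) measure \<Rightarrow> int \<Rightarrow> real ^ 'x ^ 'x" where
  "step_matrix P k = (\<chi> x y. \<P>(\<omega> in P. \<omega> k = x \<and> \<omega> (k + 1) = y))"

definition imprecise_markov_chain ::
  "(real ^ 'x ^ 'x::finite) set \<Rightarrow> (int \<Rightarrow> 'x) measure set" where
  "imprecise_markov_chain \<Q> = {P. markov_law P \<and> (\<forall>k. step_matrix P k \<in> \<Q>)}"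

text \<open>
  A probability mass function on \<open>N\<close>-tuples of states is a function on lists that vanishes on lists
  whose length is not \<open>N\<close>.
\<close>

definition joint_pmf :: "(int \<Rightarrow> 'x) measure \<Rightarrow> int \<Rightarrow> int \<Rightarrow> 'x list \<Rightarrow> real" where
  "joint_pmf P m n = (\<lambda>xs. \<P>(\<omega> in P. map \<omega> [m..n] = xs))"

definition joint_laws ::
  "(int \<Rightarrow> 'x) measure set \<Rightarrow> int \<Rightarrow> int \<Rightarrow> ('x list \<Rightarrow> real) set" where
  "joint_laws C m n = {joint_pmf P m n | P. P \<in> C}"

definition reversed_pmf :: "('x list \<Rightarrow> real) \<Rightarrow> 'x list \<Rightarrow> real" where
  "reversed_pmf p = (\<lambda>xs. p (rev xs))"

definition reversed_joint_laws ::
  "(int \<Rightarrow> 'x) measure set \<Rightarrow> int \<Rightarrow> int \<Rightarrow> ('x list \<Rightarrow> real) set" where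
  "reversed_joint_laws C m n = reversed_pmf ` joint_laws C m n"

text \<open>
  The one-dimensional laws, with mass functions on 1-tuples identified with vectors so that they
  can be compared with marginals of matrices.
\<close>

definition marginal_laws :: "(int \<Rightarrow> 'x::finite) measure set \<Rightarrow> int \<Rightarrow> (real ^ 'x) set" where
  "marginal_laws C k = {\<chi> x. p [x] | p. p \<in> joint_laws C k k}"

definition reversible :: "(int \<Rightarrow> 'x) measure set \<Rightarrow> bool" where
  "reversible C \<longleftrightarrow> (\<forall>m n. m \<le> n \<longrightarrow> reversed_joint_laws C m n = joint_laws C m n)"

definition symmetric_matrix_set :: "(real ^ 'x ^ 'x::finite) set \<Rightarrow> bool" where
  "symmetric_matrix_set \<Q> \<longleftrightarrow> transpose ` \<Q> = \<Q>"

end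

theory Submission
  imports Defs
begin

text \<open>
  The Markov property at time \<open>k\<close> is the division-free identity
  \<open>P(X\<^sub>m..X\<^sub>k\<^sub>+\<^sub>1) P(X\<^sub>k) = P(X\<^sub>m..X\<^sub>k) P(X\<^sub>k, X\<^sub>k\<^sub>+\<^sub>1)\<close>, and an induction on the length of the window shows
  that it implies its own mirror image. Hence time reversal maps Markov laws to Markov laws and
  transposes the step matrices, which gives reversibility when \<open>\<Q>\<close> is symmetric. Conversely, by
  equality of the marginal sets every \<open>Q \<in> \<Q>\<close> extends to a two-sided sequence of marginally
  compatible matrices in \<open>\<Q>\<close>, and every such sequence is realised by a Markov chain:
  \<open>X\<^sub>0\<close> is drawn first, then the future and the past are generated from it by independent random
  updates. So \<open>Q\<close> occurs as a law of \<open>(X\<^sub>0, X\<^sub>1)\<close>, and reversibility forces its transpose to be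
  in \<open>\<Q>\<close>.
\<close>

section \<open>Window probabilities\<close>

abbreviation paths :: "(int \<Rightarrow> 'x::finite) measure" where
  "paths \<equiv> \<Pi>\<^sub>M k\<in>UNIV. count_space UNIV"

text \<open>The prescribed states come from a total path, so that one \<open>x\<close> serves
  windows with different endpoints; only its values on \<open>{m..n}\<close> matter.\<close>

definition window :: "(int \<Rightarrow> 'x) measure \<Rightarrow> int \<Rightarrow> int \<Rightarrow> (int \<Rightarrow> 'x) \<Rightarrow> real" where
  "window P m n x = \<P>(\<omega> in P. \<forall>i\<in>{m..n}. \<omega> i = x i)"

lemma process_law_space: "process_law P \<Longrightarrow> space P = UNIV"
  unfolding process_law_def by (auto dest: sets_eq_imp_space_eq simp: space_PiM)

lemma process_law_prob_space: "process_law P \<Longrightarrow> prob_space P"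
  unfolding process_law_def by blast

lemma process_law_measurable: "process_law P \<Longrightarrow> measurable P N = measurable paths N"
  unfolding process_law_def by (intro measurable_cong_sets) auto

lemma process_law_coordinate:
  "process_law P \<Longrightarrow> (\<lambda>\<omega>. \<omega> i) \<in> measurable P (count_space UNIV)"
  by (simp add: process_law_measurable)

lemma process_law_sets:
  assumes "process_law P"
  shows "{\<omega>. \<omega> i = a} \<in> sets P"
proof -
  have "(\<lambda>\<omega>. \<omega> i) -` {a} \<inter> space P \<in> sets P"
    by (rule measurable_sets[OF process_law_coordinate[OF assms]]) simp
  then show ?thesis
    by (simp add: process_law_space[OF assms] vimage_def)
qed

lemma window_sets:
  assumes "process_law P"
  shows "{\<omega>. \<forall>i\<in>{m..n}. \<omega> i = x i} \<in> sets P"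
proof -
  have "{\<omega>\<in>space P. \<forall>i\<in>{m..n}. \<omega> i = x i} \<in> sets P"
    by (rule sets.sets_Collect_finite_All)
      (use process_law_sets[OF assms] in \<open>auto simp: process_law_space[OF assms]\<close>)
  then show ?thesis
    by (simp add: process_law_space[OF assms])
qed

lemma window_eq: "process_law P \<Longrightarrow> window P m n x = measure P {\<omega>. \<forall>i\<in>{m..n}. \<omega> i = x i}"
  unfolding window_def by (simp add: process_law_space)

lemma window_nonneg: "0 \<le> window P m n x"
  unfolding window_def by simp

lemma window_cong: "(\<And>i. m \<le> i \<Longrightarrow> i \<le> n \<Longrightarrow> x i = y i) \<Longrightarrow> window P m n x = window P m n y"
  unfolding window_def by simp

lemma window_mono:
  assumes "process_law P" "m \<le> m'" "n' \<le> n"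
  shows "window P m n x \<le> window P m' n' x"
proof -
  interpret prob_space P using assms(1) by (rule process_law_prob_space)
  show ?thesis
    unfolding window_eq[OF assms(1)] using assms
    by (intro finite_measure_mono window_sets) auto
qed

lemma measure_sum_coordinate:
  assumes "process_law (P :: (int \<Rightarrow> 'x::finite) measure)" "A \<in> sets P"
  shows "measure P A = (\<Sum>a\<in>UNIV. measure P (A \<inter> {\<omega>. \<omega> i = a}))"
proof -
  interpret prob_space P using assms(1) by (rule process_law_prob_space)
  have "measure P (\<Union>a\<in>UNIV. A \<inter> {\<omega>. \<omega> i = a}) = (\<Sum>a\<in>UNIV. measure P (A \<inter> {\<omega>. \<omega> i = a}))"
    by (rule finite_measure_finite_Union)
      (use assms process_law_sets[OF assms(1)] in \<open>auto simp: disjoint_family_on_def\<close>)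
  moreover have "(\<Union>a\<in>UNIV. A \<inter> {\<omega>. \<omega> i = a}) = A"
    by auto
  ultimately show ?thesis by simp
qed

lemma window_sum_right:
  fixes P :: "(int \<Rightarrow> 'x::finite) measure"
  assumes "process_law P" "m \<le> n + 1"
  shows "window P m n x = (\<Sum>a\<in>UNIV. window P m (n + 1) (x(n + 1 := a)))"
proof -
  have "{\<omega>. \<forall>i\<in>{m..n}. \<omega> i = x i} \<inter> {\<omega>. \<omega> (n + 1) = a} =
      {\<omega>. \<forall>i\<in>{m..n + 1}. \<omega> i = (x(n + 1 := a)) i}" for a
    using assms(2) by (auto simp: atLeastAtMostPlus1_int_conv)
  then show ?thesis
    unfolding window_eq[OF assms(1)]
    by (subst measure_sum_coordinate[OF assms(1) window_sets[OF assms(1)], of _ _ _ "n + 1"]) simp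
qed

lemma window_sum_left:
  fixes P :: "(int \<Rightarrow> 'x::finite) measure"
  assumes "process_law P" "m \<le> n + 1"
  shows "window P m n x = (\<Sum>a\<in>UNIV. window P (m - 1) n (x(m - 1 := a)))"
proof -
  have "{\<omega>. \<forall>i\<in>{m..n}. \<omega> i = x i} \<inter> {\<omega>. \<omega> (m - 1) = a} =
      {\<omega>. \<forall>i\<in>{m - 1..n}. \<omega> i = (x(m - 1 := a)) i}" for a
    using assms(2) by (auto simp: simp_from_to[of "m - 1"])
  then show ?thesis
    unfolding window_eq[OF assms(1)]
    by (subst measure_sum_coordinate[OF assms(1) window_sets[OF assms(1)], of _ _ _ "m - 1"]) simp
qed

section \<open>Step matrices and their marginals as window probabilities\<close>

lemma step_matrix_eq_window:
  assumes "process_law P"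
  shows "step_matrix P k $ x k $ x (k + 1) = window P k (k + 1) x"
proof -
  have "{k..k + 1} = {k, k + 1}" by auto
  then show ?thesis by (simp add: step_matrix_def window_def)
qed

lemma row_sum: "(1 v* transpose Q) $ a = (\<Sum>b\<in>UNIV. Q $ a $ b)"
  by (simp add: vector_matrix_mult_def transpose_def)

lemma column_sum: "(1 v* Q) $ b = (\<Sum>a\<in>UNIV. Q $ a $ b)"
  by (simp add: vector_matrix_mult_def)

text \<open>Summing out the state at time \<open>k + 1\<close> leaves the law of the state at time
  \<open>k\<close>; this links left marginals to one-dimensional laws.\<close>

lemma step_matrix_row_sum:
  assumes "process_law P"
  shows "(1 v* transpose (step_matrix P k)) $ a = window P k k (\<lambda>_. a)"
proof -
  have "step_matrix P k $ a $ b = window P k (k + 1) ((\<lambda>_. a)(k + 1 := b))" for b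
    using step_matrix_eq_window[OF assms, of k "(\<lambda>_. a)(k + 1 := b)"] by simp
  then show ?thesis
    unfolding row_sum by (subst window_sum_right[OF assms]) simp_all
qed

section \<open>The Markov property and time reversal\<close>

text \<open>Multiplying out the conditional probabilities absorbs null histories: for a process law
  both sides then vanish.\<close>

definition markov_at :: "(int \<Rightarrow> 'x) measure \<Rightarrow> int \<Rightarrow> bool" where
  "markov_at P k \<longleftrightarrow> (\<forall>m\<le>k. \<forall>x.
     window P m (k + 1) x * window P k k x = window P m k x * window P k (k + 1) x)"

text \<open>Given the state at \<open>k\<close>, the state at \<open>k - 1\<close> is independent of
  the states after \<open>k\<close>: the Markov property of the process run backwards.\<close>

definition rev_markov_at :: "(int \<Rightarrow> 'x) measure \<Rightarrow> int \<Rightarrow> bool" where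
  "rev_markov_at P k \<longleftrightarrow> (\<forall>n\<ge>k. \<forall>x.
     window P (k - 1) n x * window P k k x = window P k n x * window P (k - 1) k x)"

text \<open>The centre is left free: \<open>s = m + n\<close> maps the window \<open>{m..n}\<close>
  onto itself, while \<open>s = 0\<close> exchanges the past and the future of time
  \<open>0\<close>.\<close>

definition reflect :: "int \<Rightarrow> (int \<Rightarrow> 'x::finite) measure \<Rightarrow> (int \<Rightarrow> 'x) measure" where
  "reflect s P = distr P paths (\<lambda>\<omega> i. \<omega> (s - i))"

lemma markov_law_iff_markov_at: "markov_law P \<longleftrightarrow> process_law P \<and> (\<forall>k. markov_at P k)"
proof (cases "process_law P")
  case True
  interpret prob_space P using True by (rule process_law_prob_space)
  have *: "\<P>(\<omega> in P. \<omega> (k + 1) = y \<bar> \<forall>i\<in>{m..k}. \<omega> i = x i) =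
      window P m (k + 1) (x(k + 1 := y)) / window P m k x" if "m \<le> k" for m k x y
  proof -
    have "{\<omega>. \<omega> (k + 1) = y \<and> (\<forall>i\<in>{m..k}. \<omega> i = x i)} =
      {\<omega>. \<forall>i\<in>{m..k + 1}. \<omega> i = (x(k + 1 := y)) i}"
      using that by (auto simp: atLeastAtMostPlus1_int_conv)
    then show ?thesis
      by (simp add: cond_prob_def window_def process_law_space[OF True])
  qed
  have **: "\<P>(\<omega> in P. \<omega> (k + 1) = y \<bar> \<omega> k = x k) =
      window P k (k + 1) (x(k + 1 := y)) / window P k k x" for k x y
    using *[of k k y x] by simp
  have "markov_law P \<longleftrightarrow> (\<forall>m k x y. m \<le> k \<longrightarrow> window P m k x > 0 \<longrightarrow>
      window P m (k + 1) (x(k + 1 := y)) / window P m k x =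
      window P k (k + 1) (x(k + 1 := y)) / window P k k x)"
    unfolding markov_law_def using True * **
    by (simp add: window_def[symmetric] del: fun_upd_apply)
  also have "\<dots> \<longleftrightarrow> (\<forall>m k x y. m \<le> k \<longrightarrow>
      window P m (k + 1) (x(k + 1 := y)) * window P k k x =
      window P m k x * window P k (k + 1) (x(k + 1 := y)))"
  proof (intro all_cong1 imp_cong refl)
    fix m k :: int and x y
    assume "m \<le> k"
    have le: "window P m k x \<le> window P k k x"
      "window P m (k + 1) (x(k + 1 := y)) \<le> window P m k (x(k + 1 := y))"
      using \<open>m \<le> k\<close> by (auto intro: window_mono[OF True])
    have eq: "window P m k (x(k + 1 := y)) = window P m k x"
      by (rule window_cong) auto
    show "(0 < window P m k x \<longrightarrow>
        window P m (k + 1) (x(k + 1 := y)) / window P m k x =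
        window P k (k + 1) (x(k + 1 := y)) / window P k k x) \<longleftrightarrow>
      window P m (k + 1) (x(k + 1 := y)) * window P k k x =
        window P m k x * window P k (k + 1) (x(k + 1 := y))"
    \<comment> \<open>On a null history the conditional statement is vacuous, and the product
      identity reads 0 = 0 because a longer window is no more probable.\<close>
    proof (cases "window P m k x = 0")
      case True
      then have "window P m (k + 1) (x(k + 1 := y)) = 0"
        using le(2) eq window_nonneg[of P m "k + 1" "x(k + 1 := y)"] by linarith
      with True show ?thesis by simp
    next
      case False
      then have "window P m k x > 0" "window P k k x > 0"
        using le(1) window_nonneg[of P m k x] by linarith+
      then show ?thesis by (auto simp: field_simps)
    qed
  qed
  also have "\<dots> \<longleftrightarrow> (\<forall>k. markov_at P k)"
  proof -
    \<comment> \<open>The next state \<open>y\<close> is absorbed into the path: windows ending at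
      \<open>k\<close> ignore the update, and \<open>y = x (k + 1)\<close> gives back
      \<open>x\<close>.\<close>
    have "window P m k (x(k + 1 := y)) = window P m k x" for m k x y
      by (rule window_cong) auto
    then show ?thesis
      unfolding markov_at_def by (metis fun_upd_triv)
  qed
  finally show ?thesis using True by simp
qed (simp add: markov_law_def)

section \<open>Reflection of the time axis\<close>

lemma reflect_measurable:
  "process_law P \<Longrightarrow> (\<lambda>\<omega> i. \<omega> (s - i)) \<in> measurable P paths"
  by (intro measurable_PiM_single') (auto simp: process_law_coordinate)

lemma process_law_reflect: "process_law P \<Longrightarrow> process_law (reflect s P)"
  unfolding reflect_def
  by (auto simp: process_law_def[of "distr _ _ _"]
      intro: prob_space.prob_space_distr process_law_prob_space reflect_measurable)

lemma measure_reflect: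
  assumes "process_law P" "A \<in> sets P"
  shows "measure (reflect s P) A = measure P {\<omega>. (\<lambda>i. \<omega> (s - i)) \<in> A}"
  using assms reflect_measurable[OF assms(1), of s]
  by (simp add: reflect_def measure_distr process_law_space vimage_def process_law_def)

lemma window_reflect:
  assumes "process_law P"
  shows "window (reflect s P) m n x = window P (s - n) (s - m) (\<lambda>i. x (s - i))"
proof -
  have "(\<forall>i\<in>{m..n}. \<omega> (s - i) = x i) \<longleftrightarrow> (\<forall>i\<in>{s - n..s - m}. \<omega> i = x (s - i))" for \<omega>
  proof safe
    fix i assume "\<forall>i\<in>{m..n}. \<omega> (s - i) = x i" "i \<in> {s - n..s - m}"
    then show "\<omega> i = x (s - i)"
      by (auto dest: bspec[of _ _ "s - i"])
  next
    fix i assume "\<forall>i\<in>{s - n..s - m}. \<omega> i = x (s - i)" "i \<in> {m..n}"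
    then show "\<omega> (s - i) = x i"
      by (auto dest: bspec[of _ _ "s - i"])
  qed
  then show ?thesis
    using measure_reflect[OF assms window_sets[OF assms]]
    by (simp add: window_eq assms process_law_reflect)
qed

text \<open>The times \<open>k\<close> and \<open>k + 1\<close> go to \<open>s - k\<close> and
  \<open>s - k - 1\<close>. The smaller one indexes the original step matrix, and the order of the
  pair is swapped.\<close>

lemma step_matrix_reflect:
  assumes "process_law P"
  shows "step_matrix (reflect s P) k = transpose (step_matrix P (s - k - 1))"
proof -
  have "step_matrix (reflect s P) k $ a $ b = step_matrix P (s - k - 1) $ b $ a" for a b
    using step_matrix_eq_window[OF process_law_reflect[OF assms], of s k "(\<lambda>_. a)(k + 1 := b)"]
      step_matrix_eq_window[OF assms, of "s - k - 1" "(\<lambda>_. a)(s - k - 1 := b)"]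
      window_cong[of "s - k - 1" "s - k" "(\<lambda>_. a)(s - k - 1 := b)"
        "\<lambda>i. ((\<lambda>_. a)(k + 1 := b)) (s - i)" P]
    by (auto simp: window_reflect[OF assms] algebra_simps)
  then show ?thesis
    by (simp add: vec_eq_iff transpose_def)
qed

text \<open>The substitution \<open>j = s - i\<close> reverses order. Through this and the next two
  lemmas, a quantifier over starting points of windows becomes one over end points, and
  conversely.\<close>

lemma all_index_reflect: "(\<forall>i\<le>k. R (s - i)) \<longleftrightarrow> (\<forall>j\<ge>s - k. R j)" for s k :: int
proof safe
  fix j assume "\<forall>i\<le>k. R (s - i)" "s - k \<le> j"
  then show "R j" by (auto dest: spec[of _ "s - j"])
qed simp

lemma all_index_reflect': "(\<forall>i\<ge>k. R (s - i)) \<longleftrightarrow> (\<forall>j\<le>s - k. R j)" for s k :: int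
proof safe
  fix j assume "\<forall>i\<ge>k. R (s - i)" "j \<le> s - k"
  then show "R j" by (auto dest: spec[of _ "s - j"])
qed simp

lemma all_path_reflect: "(\<forall>x :: int \<Rightarrow> 'x. R (\<lambda>i. x (s - i))) \<longleftrightarrow> (\<forall>x. R x)"
proof safe
  fix x assume "\<forall>x. R (\<lambda>i. x (s - i))"
  from spec[OF this, of "\<lambda>j. x (s - j)"] show "R x" by simp
qed simp

lemma markov_at_reflect:
  assumes "process_law P"
  shows "markov_at (reflect s P) k \<longleftrightarrow> rev_markov_at P (s - k)"
proof -
  have "markov_at (reflect s P) k \<longleftrightarrow> (\<forall>m\<le>k. \<forall>x.
     window P (s - k - 1) (s - m) x * window P (s - k) (s - k) x =
     window P (s - k) (s - m) x * window P (s - k - 1) (s - k) x)"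
    unfolding markov_at_def window_reflect[OF assms]
    by (subst all_path_reflect) (simp add: algebra_simps)
  also have "\<dots> \<longleftrightarrow> rev_markov_at P (s - k)"
    unfolding rev_markov_at_def
    by (rule all_index_reflect[where R = "\<lambda>n. \<forall>x.
      window P (s - k - 1) n x * window P (s - k) (s - k) x =
      window P (s - k) n x * window P (s - k - 1) (s - k) x"])
  finally show ?thesis .
qed

lemma rev_markov_at_reflect:
  assumes "process_law P"
  shows "rev_markov_at (reflect s P) k \<longleftrightarrow> markov_at P (s - k)"
proof -
  have "rev_markov_at (reflect s P) k \<longleftrightarrow> (\<forall>n\<ge>k. \<forall>x.
     window P (s - n) (s - k + 1) x * window P (s - k) (s - k) x =
     window P (s - n) (s - k) x * window P (s - k) (s - k + 1) x)"
    unfolding rev_markov_at_def window_reflect[OF assms]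
    by (subst all_path_reflect) (simp add: algebra_simps)
  also have "\<dots> \<longleftrightarrow> markov_at P (s - k)"
    unfolding markov_at_def
    by (rule all_index_reflect'[where R = "\<lambda>m. \<forall>x.
      window P m (s - k + 1) x * window P (s - k) (s - k) x =
      window P m (s - k) x * window P (s - k) (s - k + 1) x"])
  finally show ?thesis .
qed

text \<open>Induction on the right end \<open>n\<close>. By the Markov property at \<open>n\<close>,
  extending the window to \<open>n + 1\<close> multiplies the probabilities of both long windows by
  the same ratio, so the mirrored identity persists.\<close>

lemma rev_markov_atI:
  assumes P: "process_law P" and markov: "\<And>j. k \<le> j \<Longrightarrow> markov_at P j"
  shows "rev_markov_at P k"
  unfolding rev_markov_at_def
proof (intro allI impI)
  fix n :: int and x assume "k \<le> n"
  then show "window P (k - 1) n x * window P k k x = window P k n x * window P (k - 1) k x"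
  proof (induction n rule: int_ge_induct)
    case base
    show ?case by simp
  next
    case (step n)
    have 1: "window P (k - 1) (n + 1) x * window P n n x = window P (k - 1) n x * window P n (n + 1) x"
      and 2: "window P k (n + 1) x * window P n n x = window P k n x * window P n (n + 1) x"
      using markov[OF step.hyps] step.hyps by (auto simp: markov_at_def)
    show ?case
    proof (cases "window P n n x = 0")
      case True
      have "window P (k - 1) (n + 1) x = 0" "window P k (n + 1) x = 0"
        using window_mono[OF P, of "k - 1" n n "n + 1" x] window_mono[OF P, of k n n "n + 1" x]
          window_nonneg[of P k "n + 1" x] window_nonneg[of P "k - 1" "n + 1" x] True step.hyps
        by auto
      then show ?thesis by simp
    next
      case False
      \<comment> \<open>The extra factor \<open>window P n n x\<close> lets both Markov identities
        be substituted; being nonzero, it cancels at the end.\<close>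
      have "window P n n x * (window P (k - 1) (n + 1) x * window P k k x) =
          (window P (k - 1) n x * window P k k x) * window P n (n + 1) x"
        using 1 by (simp add: mult_ac)
      also have "\<dots> = (window P k n x * window P n (n + 1) x) * window P (k - 1) k x"
        unfolding step.IH by (simp add: mult_ac)
      also have "\<dots> = window P n n x * (window P k (n + 1) x * window P (k - 1) k x)"
        using 2 by (simp add: mult_ac)
      finally show ?thesis using False by simp
    qed
  qed
qed

text \<open>Mirror image of the preceding lemma, obtained by reflecting about time \<open>0\<close>.
  It recovers the Markov property at negative times for a chain whose past was generated
  backwards.\<close>

lemma markov_atI:
  assumes P: "process_law P" and "\<And>j. j \<le> k \<Longrightarrow> rev_markov_at P j"
  shows "markov_at P k"
proof -
  have "rev_markov_at (reflect 0 P) (- k)"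
    using assms by (intro rev_markov_atI process_law_reflect) (auto simp: markov_at_reflect)
  then show ?thesis by (simp add: rev_markov_at_reflect[OF P])
qed

lemma markov_law_reflect:
  assumes "markov_law P"
  shows "markov_law (reflect s P)"
  using assms
  by (auto simp: markov_law_iff_markov_at markov_at_reflect process_law_reflect rev_markov_atI)

lemma joint_pmf_reflect:
  assumes "process_law P"
  shows "joint_pmf (reflect (m + n) P) m n = reversed_pmf (joint_pmf P m n)"
proof
  fix xs
  have "map (\<lambda>i. f (m + n - i)) [m..n] = rev (map f [m..n])" for f :: "int \<Rightarrow> 'a"
  proof (rule nth_equalityI)
    fix i assume "i < length (map (\<lambda>i. f (m + n - i)) [m..n])"
    then have "i < nat (n - m + 1)" "m + int (length [m..n] - Suc i) = n - int i" by auto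
    then show "map (\<lambda>i. f (m + n - i)) [m..n] ! i = rev (map f [m..n]) ! i"
      by (simp add: rev_nth)
  qed simp
  then have *: "map (\<lambda>i. \<omega> (m + n - i)) [m..n] = xs \<longleftrightarrow> map \<omega> [m..n] = rev xs" for \<omega> :: "int \<Rightarrow> 'a"
    by (metis rev_rev_ident)
  \<comment> \<open>Measurability: a list of the right length describes a window event, and any
    other list the empty event.\<close>
  have "{\<omega>. map \<omega> [m..n] = xs} \<in> sets P"
  proof (cases "length xs = length [m..n]")
    case True
    have "{\<omega>. map \<omega> [m..n] = xs} = {\<omega>. \<forall>i\<in>{m..n}. \<omega> i = xs ! nat (i - m)}"
    proof safe
      fix \<omega> :: "int \<Rightarrow> 'a" and i assume "i \<in> {m..n}"
      then show "\<omega> i = map \<omega> [m..n] ! nat (i - m)" by simp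
    next
      fix \<omega> :: "int \<Rightarrow> 'a" assume "\<forall>i\<in>{m..n}. \<omega> i = xs ! nat (i - m)"
      with True show "map \<omega> [m..n] = xs"
        by (intro nth_equalityI) auto
    qed
    then show ?thesis by (simp add: window_sets[OF assms])
  next
    case False
    then have "{\<omega>. map \<omega> [m..n] = xs} = {}" by auto
    then show ?thesis by simp
  qed
  from measure_reflect[OF assms this, of "m + n"]
  show "joint_pmf (reflect (m + n) P) m n xs = reversed_pmf (joint_pmf P m n) xs"
    by (simp add: joint_pmf_def reversed_pmf_def process_law_space assms process_law_reflect *)
qed

section \<open>Chains with prescribed step matrices\<close>

text \<open>Normalise \<open>f\<close>; if its total is zero then \<open>f\<close> vanishes and any
  \<open>p\<close> will do. Applied to rows and columns of a matrix, this gives transition kernels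
  that are defined even at states of mass zero.\<close>

lemma exists_scaled_pmf:
  fixes f :: "'x::finite \<Rightarrow> real"
  assumes "\<And>y. 0 \<le> f y"
  shows "\<exists>p. \<forall>y. (\<Sum>z\<in>UNIV. f z) * pmf p y = f y"
proof (cases "(\<Sum>z\<in>UNIV. f z) = 0")
  case True
  then have "f y = 0" for y
    using assms by (simp add: sum_nonneg_eq_0_iff)
  then show ?thesis using True by simp
next
  case False
  define s where "s = (\<Sum>z\<in>UNIV. f z)"
  have s: "s > 0" using False assms by (simp add: s_def less_le sum_nonneg)
  have "(\<integral>\<^sup>+ y. ennreal (f y / s) \<partial>count_space UNIV) = 1"
    using s assms
    by (simp add: nn_integral_count_space_finite sum_ennreal flip: sum_divide_distrib s_def)
  then have "pmf (embed_pmf (\<lambda>y. f y / s)) y = f y / s" for y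
    using s assms by (intro pmf_embed_pmf) auto
  then show ?thesis
    using s by (intro exI[of _ "embed_pmf (\<lambda>y. f y / s)"]) (simp flip: s_def)
qed

text \<open>
  The update \<open>U (Some (k, a))\<close> moves the chain away from time \<open>0\<close> when it is in state \<open>a\<close> at
  time \<open>k\<close>: to time \<open>k + 1\<close> if \<open>k \<ge> 0\<close>, and for \<open>k < 0\<close> it produces the state at time \<open>k\<close>
  from the state \<open>a\<close> at time \<open>k + 1\<close>. \<open>U None\<close> is the state at time \<open>0\<close>.
\<close>

primrec forward_path :: "((int \<times> 'x) option \<Rightarrow> 'x) \<Rightarrow> nat \<Rightarrow> 'x" where
  "forward_path U 0 = U None"
| "forward_path U (Suc n) = U (Some (int n, forward_path U n))"

primrec backward_path :: "((int \<times> 'x) option \<Rightarrow> 'x) \<Rightarrow> nat \<Rightarrow> 'x" where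
  "backward_path U 0 = U None"
| "backward_path U (Suc n) = U (Some (- int n - 1, backward_path U n))"

definition path_of :: "((int \<times> 'x) option \<Rightarrow> 'x) \<Rightarrow> int \<Rightarrow> 'x" where
  "path_of U k = (if 0 \<le> k then forward_path U (nat k) else backward_path U (nat (- k)))"

lemma path_of_0: "path_of U 0 = U None"
  by (simp add: path_of_def)

lemma path_of_forward: "0 \<le> k \<Longrightarrow> path_of U (k + 1) = U (Some (k, path_of U k))"
  by (simp add: path_of_def nat_add_distrib)

lemma path_of_backward:
  assumes "k < 0"
  shows "path_of U k = U (Some (k, path_of U (k + 1)))"
proof -
  obtain n where "k = - int n - 1"
    using assms that[of "nat (- k - 1)"] by auto
  then show ?thesis
    by (cases n) (auto simp: path_of_def nat_add_distrib)
qed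

text \<open>For \<open>m\<close> at most \<open>0\<close> and \<open>n\<close> at least
  \<open>0\<close>, these are the updates consulted by a path that follows \<open>x\<close> on
  \<open>{m..n}\<close>. The set depends on \<open>x\<close> because an index records the current
  state.\<close>

definition window_updates :: "int \<Rightarrow> int \<Rightarrow> (int \<Rightarrow> 'x) \<Rightarrow> (int \<times> 'x) option set" where
  "window_updates m n x = insert None
     ((\<lambda>k. Some (k, x k)) ` {0..<n} \<union> (\<lambda>k. Some (k, x (k + 1))) ` {m..<0})"

fun update_value :: "(int \<Rightarrow> 'x) \<Rightarrow> (int \<times> 'x) option \<Rightarrow> 'x" where
  "update_value x None = x 0"
| "update_value x (Some (k, _)) = (if 0 \<le> k then x (k + 1) else x k)"

lemma finite_window_updates: "finite (window_updates m n x)"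
  by (simp add: window_updates_def)

text \<open>One more time step consults exactly one fresh update, so the probability of the window
  gains exactly one factor.\<close>

lemma window_updates_right:
  assumes "0 \<le> n"
  shows "window_updates m (n + 1) x = insert (Some (n, x n)) (window_updates m n x)"
    and "Some (n, x n) \<notin> window_updates m n x"
proof -
  have "{0..<n + 1} = insert n {0..<n}" using assms by auto
  then show "window_updates m (n + 1) x = insert (Some (n, x n)) (window_updates m n x)"
    unfolding window_updates_def by auto
  show "Some (n, x n) \<notin> window_updates m n x"
    using assms by (auto simp: window_updates_def)
qed

lemma window_updates_left:
  assumes "m \<le> 0"
  shows "window_updates (m - 1) n x = insert (Some (m - 1, x m)) (window_updates m n x)"
    and "Some (m - 1, x m) \<notin> window_updates m n x"
proof -
  have "{m - 1..<0} = insert (m - 1) {m..<0}" using assms by auto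
  then show "window_updates (m - 1) n x = insert (Some (m - 1, x m)) (window_updates m n x)"
    unfolding window_updates_def by auto
  show "Some (m - 1, x m) \<notin> window_updates m n x"
    using assms by (auto simp: window_updates_def)
qed

text \<open>As long as the path agrees with \<open>x\<close>, the indices of the updates it reads
  are determined by \<open>x\<close>. A window event thus fixes finitely many coordinates of
  \<open>U\<close>; the converse is by induction outwards from time \<open>0\<close>.\<close>

lemma path_of_window:
  assumes "m \<le> 0" "0 \<le> n"
  shows "(\<forall>i\<in>{m..n}. path_of U i = x i) \<longleftrightarrow> (\<forall>j\<in>window_updates m n x. U j = update_value x j)"
proof
  assume path: "\<forall>i\<in>{m..n}. path_of U i = x i"
  have "U None = x 0"
    using path assms by (simp flip: path_of_0)
  moreover have "U (Some (k, x k)) = x (k + 1)" if "0 \<le> k" "k < n" for k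
    using path_of_forward[of k U] path assms that by auto
  moreover have "U (Some (k, x (k + 1))) = x k" if "m \<le> k" "k < 0" for k
    using path_of_backward[of k U] path assms that by auto
  ultimately show "\<forall>j\<in>window_updates m n x. U j = update_value x j"
    by (auto simp: window_updates_def)
next
  assume U: "\<forall>j\<in>window_updates m n x. U j = update_value x j"
  have 0: "U None = x 0"
    using U by (simp add: window_updates_def)
  have fwd: "U (Some (k, x k)) = x (k + 1)" if "0 \<le> k" "k < n" for k
    using U that by (auto simp: window_updates_def)
  have bwd: "U (Some (k, x (k + 1))) = x k" if "m \<le> k" "k < 0" for k
    using U that by (auto simp: window_updates_def)
  have "path_of U i = x i" if "0 \<le> i" "i \<le> n" for i
    using that by (induction i rule: int_ge_induct) (auto simp: path_of_0 path_of_forward 0 fwd)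
  moreover have "path_of U i = x i" if "i \<le> 0" "m \<le> i" for i
    using that
  proof (induction i rule: int_le_induct)
    case (step i)
    then show ?case using bwd[of "i - 1"] by (simp add: path_of_backward[of "i - 1"])
  qed (simp add: path_of_0 0)
  ultimately show "\<forall>i\<in>{m..n}. path_of U i = x i"
    by (metis atLeastAtMost_iff linear)
qed

section \<open>The law of a chain driven by independent updates\<close>

definition update_law :: "((int \<times> 'x) option \<Rightarrow> 'x pmf) \<Rightarrow> ((int \<times> 'x) option \<Rightarrow> 'x) measure" where
  "update_law K = (\<Pi>\<^sub>M j\<in>UNIV. measure_pmf (K j))"

definition chain_law :: "((int \<times> 'x) option \<Rightarrow> 'x pmf) \<Rightarrow> (int \<Rightarrow> 'x::finite) measure" where
  "chain_law K = distr (update_law K) paths path_of"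

lemma update_law_coordinate: "(\<lambda>U. U j) \<in> measurable (update_law K) (count_space UNIV)"
proof -
  have "(\<lambda>U. U j) \<in> measurable (update_law K) (measure_pmf (K j))"
    unfolding update_law_def by (rule measurable_component_singleton) simp
  then show ?thesis by (simp cong: measurable_cong_sets)
qed

lemma path_of_measurable:
  "(path_of :: _ \<Rightarrow> int \<Rightarrow> 'x::finite) \<in> measurable (update_law K) paths"
proof -
  \<comment> \<open>The coordinate that is read depends on the random state \<open>g U\<close>;
    measurability follows by splitting over the finitely many values of that state.\<close>
  have step: "(\<lambda>U. U (Some (k, g U))) \<in> measurable (update_law K) (count_space UNIV)"
    if "g \<in> measurable (update_law K) (count_space UNIV)" for k and g :: "_ \<Rightarrow> 'x"
    by (rule measurable_compose_countable'[OF update_law_coordinate that])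
      (simp add: countable_finite)
  have "(\<lambda>U. forward_path U n) \<in> measurable (update_law K) (count_space (UNIV :: 'x set))"
    and "(\<lambda>U. backward_path U n) \<in> measurable (update_law K) (count_space (UNIV :: 'x set))" for n
    by (induction n) (simp_all add: update_law_coordinate step)
  then have "(\<lambda>U. path_of U k) \<in> measurable (update_law K) (count_space (UNIV :: 'x set))" for k
    by (cases "0 \<le> k") (simp_all add: path_of_def)
  then show ?thesis
    by (intro measurable_PiM_single') auto
qed

lemma prob_space_update_law: "prob_space (update_law K)"
  unfolding update_law_def by (rule prob_space_PiM) (rule measure_pmf.prob_space_axioms)

lemma process_law_chain_law: "process_law (chain_law K)"
  unfolding process_law_def chain_law_def
  by (auto intro: prob_space.prob_space_distr[OF prob_space_update_law] path_of_measurable)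

lemma window_chain_law:
  assumes "m \<le> 0" "0 \<le> n"
  shows "window (chain_law K) m n x = (\<Prod>j\<in>window_updates m n x. pmf (K j) (update_value x j))"
proof -
  interpret product_prob_space "\<lambda>j. measure_pmf (K j)" UNIV
    by unfold_locales
  have space: "space (update_law K) = UNIV"
    by (simp add: update_law_def space_PiM)
  have "window (chain_law K) m n x =
      measure (update_law K) {U. \<forall>i\<in>{m..n}. path_of U i = x i}"
    using window_sets[OF process_law_chain_law, of m n x K] path_of_measurable[of K]
    unfolding window_eq[OF process_law_chain_law] unfolding chain_law_def
    by (simp add: measure_distr space vimage_def)
  also have "\<dots> = measure (update_law K)
      {U\<in>space (update_law K). \<forall>j\<in>window_updates m n x. U j \<in> {update_value x j}}"
    by (simp add: path_of_window[OF assms] space)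
  also have "\<dots> = (\<Prod>j\<in>window_updates m n x. measure (measure_pmf (K j)) {update_value x j})"
    unfolding update_law_def measure_def
    by (subst emeasure_PiM_Collect)
      (simp_all add: finite_window_updates emeasure_pmf_single measure_pmf_single
        prod_ennreal prod_nonneg)
  finally show ?thesis by (simp add: measure_pmf_single)
qed

lemma window_chain_law_right:
  assumes "m \<le> 0" "0 \<le> n"
  shows "window (chain_law K) m (n + 1) x =
    window (chain_law K) m n x * pmf (K (Some (n, x n))) (x (n + 1))"
  using assms window_updates_right[where m = m and n = n and x = x]
  by (simp add: window_chain_law finite_window_updates mult.commute)

lemma window_chain_law_left:
  assumes "m \<le> 0" "0 \<le> n"
  shows "window (chain_law K) (m - 1) n x =
    window (chain_law K) m n x * pmf (K (Some (m - 1, x m))) (x (m - 1))"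
  using assms window_updates_left[where m = m and n = n and x = x]
  by (simp add: window_chain_law finite_window_updates mult.commute)

text \<open>Stated for a general process so that it serves twice: for the constructed chain with its
  forward kernels, and for its reflection with the backward ones. The factorisation is assumed only
  for windows that reach back to time \<open>0\<close>.\<close>

lemma forward_markov_from_kernel:
  fixes P :: "(int \<Rightarrow> 'x::finite) measure" and Q :: "int \<Rightarrow> real ^ 'x ^ 'x"
  assumes P: "process_law P"
    and kernel: "\<And>m k x. m \<le> 0 \<Longrightarrow> 0 \<le> k \<Longrightarrow>
      window P m (k + 1) x = window P m k x * A k (x k) (x (k + 1))"
    and init: "\<And>x. window P 0 0 x = (1 v* transpose (Q 0)) $ x 0"
    and A: "\<And>k a b. 0 \<le> k \<Longrightarrow> (1 v* transpose (Q k)) $ a * A k a b = Q k $ a $ b"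
    and compatible: "\<And>k. 1 v* Q k = 1 v* transpose (Q (k + 1))"
    and k: "0 \<le> k"
  shows "markov_at P k" and "step_matrix P k = Q k"
proof -
  have kernel': "window P m (k + 1) x = window P m k x * A k (x k) (x (k + 1))"
    if "m \<le> k" "0 \<le> k" for m k x
  proof (cases "m \<le> 0")
    case True
    then show ?thesis using kernel that by blast
  next
    case False
    then have "0 \<le> m" by simp
    then show ?thesis using that(1)
    proof (induction m arbitrary: x rule: int_ge_induct)
      case base
      then show ?case using kernel by simp
    next
      case (step m)
      \<comment> \<open>The state at time \<open>m\<close> is summed out; the kernel factor does not
        involve it, since \<open>m < k\<close>.\<close>
      have "window P (m + 1) (k + 1) x = (\<Sum>a\<in>UNIV. window P m (k + 1) (x(m := a)))"
        using window_sum_left[OF P, of "m + 1" "k + 1" x] step.prems by simp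
      also have "\<dots> = (\<Sum>a\<in>UNIV. window P m k (x(m := a)) * A k (x k) (x (k + 1)))"
        by (intro sum.cong refl, subst step.IH) (use step.prems in auto)
      also have "\<dots> = window P (m + 1) k x * A k (x k) (x (k + 1))"
        using window_sum_left[OF P, of "m + 1" k x] step.prems by (simp add: sum_distrib_right)
      finally show ?case .
    qed
  qed
  have pair: "window P k (k + 1) x = Q k $ x k $ x (k + 1)"
    if "0 \<le> k" "\<And>x. window P k k x = (1 v* transpose (Q k)) $ x k" for k x
    using kernel'[of k k x] A[of k "x k" "x (k + 1)"] that by simp
  have single: "window P k k x = (1 v* transpose (Q k)) $ x k" if "0 \<le> k" for k x
    using that
  proof (induction k arbitrary: x rule: int_ge_induct)
    case base
    show ?case by (rule init)
  next
    case (step k)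
    \<comment> \<open>The column sums of \<open>Q k\<close> give the law at time
      \<open>k + 1\<close>, and compatibility identifies them with the row sums of
      \<open>Q (k + 1)\<close>.\<close>
    have "window P (k + 1) (k + 1) x = (\<Sum>a\<in>UNIV. Q k $ a $ x (k + 1))"
      using window_sum_left[OF P, of "k + 1" "k + 1" x] pair[OF step.hyps step.IH] by simp
    also have "\<dots> = (1 v* transpose (Q (k + 1))) $ x (k + 1)"
      by (simp only: column_sum compatible[symmetric])
    finally show ?case .
  qed
  show "markov_at P k"
    unfolding markov_at_def using kernel'[of _ k] k by (auto simp: mult_ac)
  have "step_matrix P k $ a $ b = Q k $ a $ b" for a b
    using step_matrix_eq_window[OF P, of k "(\<lambda>_. a)(k + 1 := b)"]
      pair[OF k single[OF k], of "(\<lambda>_. a)(k + 1 := b)"] by simp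
  then show "step_matrix P k = Q k" by (simp add: vec_eq_iff)
qed

lemma exists_markov_law:
  fixes Q :: "int \<Rightarrow> real ^ 'x ^ 'x::finite"
  assumes Q: "\<And>k. joint_distribution_matrix (Q k)"
    and compatible: "\<And>k. 1 v* Q k = 1 v* transpose (Q (k + 1))"
  shows "\<exists>P. markov_law P \<and> (\<forall>k. step_matrix P k = Q k)"
proof -
  have nonneg: "0 \<le> Q k $ a $ b" for k a b
    using Q by (simp add: joint_distribution_matrix_def)
  have "\<exists>p. \<forall>b. (1 v* transpose (Q k)) $ a * pmf p b = Q k $ a $ b" for k a
    using exists_scaled_pmf[of "\<lambda>b. Q k $ a $ b"] nonneg unfolding row_sum by simp
  then obtain A where A: "(1 v* transpose (Q k)) $ a * pmf (A k a) b = Q k $ a $ b" for k a b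
    by metis
  \<comment> \<open>Normalised columns: \<open>B k b\<close> plays the role of the law of the state
    at \<open>k\<close> given state \<open>b\<close> at \<open>k + 1\<close>.\<close>
  have "\<exists>p. \<forall>a. (1 v* Q k) $ b * pmf p a = Q k $ a $ b" for k b
    using exists_scaled_pmf[of "\<lambda>a. Q k $ a $ b"] nonneg unfolding column_sum by simp
  then obtain B where B: "(1 v* Q k) $ b * pmf (B k b) a = Q k $ a $ b" for k a b
    by metis
  have "\<exists>p. \<forall>a. pmf p a = (1 v* transpose (Q 0)) $ a"
    using exists_scaled_pmf[of "\<lambda>a. (1 v* transpose (Q 0)) $ a"] nonneg Q[of 0]
    unfolding row_sum by (simp add: joint_distribution_matrix_def sum_nonneg)
  then obtain p where p: "pmf p a = (1 v* transpose (Q 0)) $ a" for a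
    by metis
  define K where "K j = (case j of None \<Rightarrow> p | Some (k, a) \<Rightarrow> if 0 \<le> k then A k a else B k a)" for j
  define P where "P = chain_law K"
  define P' where "P' = reflect 0 P"
  have P: "process_law P" and P': "process_law P'"
    unfolding P'_def P_def by (auto intro: process_law_chain_law process_law_reflect)
  have init: "window P 0 0 x = (1 v* transpose (Q 0)) $ x 0" for x
    by (simp add: P_def window_chain_law window_updates_def K_def p)
  have forward: "markov_at P k" "step_matrix P k = Q k" if "0 \<le> k" for k
  proof -
    have kernel: "window P m (k + 1) x = window P m k x * pmf (A k (x k)) (x (k + 1))"
      if "m \<le> 0" "0 \<le> k" for m k x
      using that by (simp add: P_def window_chain_law_right K_def)
    show "markov_at P k" "step_matrix P k = Q k"
      using forward_markov_from_kernel[OF P kernel init A compatible that] by blast+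
  qed
  have backward: "markov_at P' k" "step_matrix P' k = transpose (Q (- k - 1))" if "0 \<le> k" for k
  proof -
    have kernel: "window P' m (k + 1) x = window P' m k x * pmf (B (- k - 1) (x k)) (x (k + 1))"
      if "m \<le> 0" "0 \<le> k" for m k x
      using that window_chain_law_left[of "- k" "- m" K "\<lambda>i. x (- i)"]
      by (simp add: P'_def P_def window_reflect[OF process_law_chain_law] K_def add.commute
          minus_diff_commute)
    \<comment> \<open>The first step matrix of the reflected chain is the transpose of
      \<open>Q (- 1)\<close>; its row sums are the column sums of \<open>Q (- 1)\<close>, hence the
      row sums of \<open>Q 0\<close>.\<close>
    have init': "window P' 0 0 x = (1 v* transpose (transpose (Q (- 0 - 1)))) $ x 0" for x
      using init[of "\<lambda>i. x (- i)"] compatible[of "- 1"]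
      by (simp add: P'_def window_reflect[OF P])
    have B': "(1 v* transpose (transpose (Q (- k - 1)))) $ a * pmf (B (- k - 1) a) b =
      transpose (Q (- k - 1)) $ a $ b" for k a b
      by (simp only: transpose_transpose B) (simp add: transpose_def)
    have compatible': "1 v* transpose (Q (- k - 1)) = 1 v* transpose (transpose (Q (- (k + 1) - 1)))"
      for k
    proof -
      have "- (k + 1) - 1 + 1 = - k - 1" by simp
      then show ?thesis
        using compatible[of "- (k + 1) - 1"] by (simp only: transpose_transpose)
    qed
    show "markov_at P' k" "step_matrix P' k = transpose (Q (- k - 1))"
      using forward_markov_from_kernel[of P' "\<lambda>k a b. pmf (B (- k - 1) a) b"
          "\<lambda>k. transpose (Q (- k - 1))", OF P' kernel init' B' compatible' that]
      by blast+
  qed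
  \<comment> \<open>The past satisfies the mirrored property only; \<open>markov_atI\<close>
    converts it at negative times, while nonnegative times are covered by
    \<open>forward\<close>.\<close>
  have "rev_markov_at P k" if "k \<le> 0" for k
    using backward(1)[of "- k"] that by (simp add: P'_def markov_at_reflect[OF P])
  then have "markov_at P k" for k
    using forward(1)[of k] markov_atI[OF P, of k] by (cases "0 \<le> k") auto
  moreover have "step_matrix P k = Q k" for k
  proof (cases "0 \<le> k")
    case False
    then have "transpose (step_matrix P k) = transpose (Q k)"
      using backward(2)[of "- k - 1"] by (simp add: P'_def step_matrix_reflect[OF P])
    then show ?thesis by (metis transpose_transpose)
  qed (rule forward(2))
  ultimately show ?thesis
    using P by (auto simp: markov_law_iff_markov_at)
qed

section \<open>Stationarity and reversibility\<close>

text \<open>Equality of the marginal sets gives each matrix in \<open>\<Q>\<close> a compatible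
  successor \<open>F\<close> and a compatible predecessor \<open>B\<close> in \<open>\<Q>\<close>.
  Both are iterated from \<open>M\<close>, placed at index \<open>k\<close>.\<close>

lemma exists_compatible_sequence:
  assumes eq: "left_marginals \<Q> = right_marginals \<Q>" and M: "M \<in> \<Q>"
  shows "\<exists>Q. (\<forall>j. Q j \<in> \<Q>) \<and> (\<forall>j. 1 v* Q j = 1 v* transpose (Q (j + 1))) \<and> Q (k :: int) = M"
proof -
  have "\<exists>N\<in>\<Q>. 1 v* L = 1 v* transpose N" if "L \<in> \<Q>" for L
  proof -
    have "1 v* L \<in> right_marginals \<Q>" using that unfolding right_marginals_def by blast
    then show ?thesis unfolding eq[symmetric] left_marginals_def by blast
  qed
  then obtain F where F: "\<And>L. L \<in> \<Q> \<Longrightarrow> F L \<in> \<Q>" "\<And>L. L \<in> \<Q> \<Longrightarrow> 1 v* L = 1 v* transpose (F L)"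
    by metis
  have "\<exists>N\<in>\<Q>. 1 v* transpose L = 1 v* N" if "L \<in> \<Q>" for L
  proof -
    have "1 v* transpose L \<in> left_marginals \<Q>" using that unfolding left_marginals_def by blast
    then show ?thesis unfolding eq right_marginals_def by blast
  qed
  then obtain B where B: "\<And>L. L \<in> \<Q> \<Longrightarrow> B L \<in> \<Q>" "\<And>L. L \<in> \<Q> \<Longrightarrow> 1 v* transpose L = 1 v* B L"
    by metis
  have Fn: "(F ^^ n) M \<in> \<Q>" and Bn: "(B ^^ n) M \<in> \<Q>" for n
    by (induction n) (simp_all add: M F(1) B(1))
  define Q where "Q j = (if k \<le> j then (F ^^ nat (j - k)) M else (B ^^ nat (k - j)) M)" for j
  have "1 v* Q j = 1 v* transpose (Q (j + 1))" for j
  proof (cases "k \<le> j")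
    case True
    then have "nat (j + 1 - k) = Suc (nat (j - k))" by simp
    then show ?thesis using True F(2)[OF Fn]
      by (simp add: Q_def del: transpose_matrix_vector vector_transpose_matrix)
  next
    case False
    then have "nat (k - j) = Suc (nat (k - (j + 1)))" by simp
    \<comment> \<open>For \<open>j + 1 = k\<close> the other branch of \<open>Q\<close> applies, but
      both zeroth iterates are \<open>M\<close>.\<close>
    moreover have "Q (j + 1) = (B ^^ nat (k - (j + 1))) M"
      using False by (auto simp: Q_def)
    ultimately show ?thesis using False B(2)[OF Bn]
      by (simp add: Q_def del: transpose_matrix_vector vector_transpose_matrix)
  qed
  moreover have "Q j \<in> \<Q>" for j by (simp add: Q_def Fn Bn)
  ultimately show ?thesis by (intro exI[of _ Q]) (simp add: Q_def)
qed

lemma exists_chain_with_step: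
  assumes "\<And>Q. Q \<in> \<Q> \<Longrightarrow> joint_distribution_matrix Q"
    and "left_marginals \<Q> = right_marginals \<Q>" and "M \<in> \<Q>"
  shows "\<exists>P\<in>imprecise_markov_chain \<Q>. step_matrix P k = M"
proof -
  obtain Q where "\<forall>j. Q j \<in> \<Q>" "\<forall>j. 1 v* Q j = 1 v* transpose (Q (j + 1))" "Q k = M"
    using exists_compatible_sequence[OF assms(2,3)] by blast
  moreover from this obtain P where "markov_law P" "\<forall>j. step_matrix P j = Q j"
    using exists_markov_law[of Q] assms(1) by blast
  ultimately show ?thesis
    by (intro bexI[of _ P]) (auto simp: imprecise_markov_chain_def)
qed

lemma imprecise_markov_chain_process_law: "P \<in> imprecise_markov_chain \<Q> \<Longrightarrow> process_law P"
  by (simp add: imprecise_markov_chain_def markov_law_def)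

lemma step_matrix_eq_joint_pmf: "step_matrix P 0 $ a $ b = joint_pmf P 0 1 [a, b]"
  by (simp add: step_matrix_def joint_pmf_def upto.simps)

lemma reversed_pmf_involution: "reversed_pmf (reversed_pmf p) = p"
  by (simp add: reversed_pmf_def)

lemma reflect_in_imprecise_markov_chain:
  assumes "symmetric_matrix_set \<Q>" "P \<in> imprecise_markov_chain \<Q>"
  shows "reflect s P \<in> imprecise_markov_chain \<Q>"
proof -
  have "transpose (step_matrix P k) \<in> \<Q>" for k
    using assms unfolding symmetric_matrix_set_def imprecise_markov_chain_def by blast
  then show ?thesis
    using assms(2) imprecise_markov_chain_process_law[OF assms(2)]
    by (simp add: imprecise_markov_chain_def markov_law_reflect step_matrix_reflect)
qed

lemma marginal_laws_imprecise_markov_chain: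
  assumes "\<And>Q. Q \<in> \<Q> \<Longrightarrow> joint_distribution_matrix Q"
    and "left_marginals \<Q> = right_marginals \<Q>"
  shows "marginal_laws (imprecise_markov_chain \<Q>) k = left_marginals \<Q>"
proof -
  have *: "(\<chi> a. joint_pmf P k k [a]) = 1 v* transpose (step_matrix P k)"
    if "P \<in> imprecise_markov_chain \<Q>" for P
    using step_matrix_row_sum[OF imprecise_markov_chain_process_law[OF that], of k]
    by (simp only: vec_eq_iff) (simp add: joint_pmf_def window_def)
  have "marginal_laws (imprecise_markov_chain \<Q>) k =
      (\<lambda>P. \<chi> a. joint_pmf P k k [a]) ` imprecise_markov_chain \<Q>"
    unfolding marginal_laws_def joint_laws_def by blast
  also have "\<dots> = (\<lambda>P. 1 v* transpose (step_matrix P k)) ` imprecise_markov_chain \<Q>"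
    by (rule image_cong[OF refl *])
  also have "\<dots> = (\<lambda>Q. 1 v* transpose Q) ` (\<lambda>P. step_matrix P k) ` imprecise_markov_chain \<Q>"
    by (simp only: image_image)
  \<comment> \<open>Every matrix of \<open>\<Q>\<close> occurs at time \<open>k\<close> in some
    compatible process, so nothing of \<open>\<Q>\<close> is lost.\<close>
  also have "(\<lambda>P. step_matrix P k) ` imprecise_markov_chain \<Q> = \<Q>"
    using exists_chain_with_step[OF assms, of _ k]
    by (auto simp: imprecise_markov_chain_def image_iff)
  finally show ?thesis
    by (auto simp only: left_marginals_def)
qed

lemma symmetric_imp_reversible:
  assumes "symmetric_matrix_set \<Q>"
  shows "reversible (imprecise_markov_chain \<Q>)"
proof -
  have sub: "reversed_joint_laws (imprecise_markov_chain \<Q>) m n \<subseteq>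
      joint_laws (imprecise_markov_chain \<Q>) m n" for m n
  proof
    fix p assume "p \<in> reversed_joint_laws (imprecise_markov_chain \<Q>) m n"
    then obtain P where P: "P \<in> imprecise_markov_chain \<Q>" "p = reversed_pmf (joint_pmf P m n)"
      by (auto simp: reversed_joint_laws_def joint_laws_def)
    then have "p = joint_pmf (reflect (m + n) P) m n"
      by (simp add: joint_pmf_reflect imprecise_markov_chain_process_law)
    with reflect_in_imprecise_markov_chain[OF assms P(1)]
    show "p \<in> joint_laws (imprecise_markov_chain \<Q>) m n"
      unfolding joint_laws_def by blast
  qed
  \<comment> \<open>Reversal is an involution, so applying it to the first inclusion yields the
    opposite one.\<close>
  moreover have "joint_laws (imprecise_markov_chain \<Q>) m n \<subseteq>
      reversed_joint_laws (imprecise_markov_chain \<Q>) m n" for m n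
    using image_mono[OF sub[of m n], of reversed_pmf]
    by (simp add: reversed_joint_laws_def image_image reversed_pmf_involution)
  ultimately show ?thesis
    unfolding reversible_def by blast
qed

text \<open>Windows of two consecutive times suffice: the law of such a pair is its step matrix, and
  reversing the pair transposes it.\<close>

lemma reversible_imp_symmetric:
  assumes "\<And>Q. Q \<in> \<Q> \<Longrightarrow> joint_distribution_matrix Q"
    and "left_marginals \<Q> = right_marginals \<Q>"
    and "reversible (imprecise_markov_chain \<Q>)"
  shows "symmetric_matrix_set \<Q>"
proof -
  have sub: "transpose Q \<in> \<Q>" if Q: "Q \<in> \<Q>" for Q
  proof -
    obtain P where P: "P \<in> imprecise_markov_chain \<Q>" "step_matrix P 0 = Q"
      using exists_chain_with_step[OF assms(1,2) Q] by blast
    have "reversed_pmf (joint_pmf P 0 1) \<in> reversed_joint_laws (imprecise_markov_chain \<Q>) 0 1"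
      unfolding reversed_joint_laws_def joint_laws_def using P(1) by blast
    also have "\<dots> = joint_laws (imprecise_markov_chain \<Q>) 0 1"
      using assms(3) by (simp add: reversible_def)
    finally have "reversed_pmf (joint_pmf P 0 1) \<in> joint_laws (imprecise_markov_chain \<Q>) 0 1" .
    then obtain P' where P': "P' \<in> imprecise_markov_chain \<Q>"
      "joint_pmf P' 0 1 = reversed_pmf (joint_pmf P 0 1)"
      by (auto simp: joint_laws_def)
    have "step_matrix P' 0 $ a $ b = transpose Q $ a $ b" for a b
      unfolding P(2)[symmetric]
      by (simp add: step_matrix_eq_joint_pmf P'(2) reversed_pmf_def transpose_def)
    then have "step_matrix P' 0 = transpose Q" by (simp add: vec_eq_iff)
    moreover have "step_matrix P' 0 \<in> \<Q>"
      using P'(1) by (simp add: imprecise_markov_chain_def)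
    ultimately show ?thesis by simp
  qed
  show ?thesis
    unfolding symmetric_matrix_set_def
  proof safe
    fix Q assume "Q \<in> \<Q>"
    then show "transpose Q \<in> \<Q>" by (rule sub)
  next
    fix Q assume "Q \<in> \<Q>"
    then show "Q \<in> transpose ` \<Q>"
      by (intro image_eqI[of Q transpose "transpose Q"] sub) (simp add: transpose_transpose)
  qed
qed

theorem theorem3:
  fixes \<Q> :: "(real ^ 'x ^ 'x::finite) set"
  assumes "\<And>Q. Q \<in> \<Q> \<Longrightarrow> joint_distribution_matrix Q"
    and "left_marginals \<Q> = right_marginals \<Q>"
  shows "(\<forall>k. marginal_laws (imprecise_markov_chain \<Q>) k = left_marginals \<Q>) \<and>
    (reversible (imprecise_markov_chain \<Q>) \<longleftrightarrow> symmetric_matrix_set \<Q>)"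
  using marginal_laws_imprecise_markov_chain[OF assms] symmetric_imp_reversible
    reversible_imp_symmetric[OF assms]
  by blast

end
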